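(* For every $n\ge 1$ and every signature $\sigma$ of the fan graph $F_n = K_1\vee P_n$, $l(F_n,\sigma) = p^-_{\triangle}(F_n,\sigma)$.
   Context: All graphs are finite, simple and undirected. A signed graph $\Sigma=(G,\sigma)$ is a graph $G$ with a signature $\sigma:E(G)\to\{+1,-1\}$. The sign of a cycle is the product of the signs of its edges; $\Sigma$ is balanced if all its cycles are positive. The frustration index $l(\Sigma)$ is the minimum number of edges whose deletion makes $\Sigma$ balanced. $p^-_{\triangle}(\Sigma)$ is the maximum number of pairwise edge-disjoint negative triangles in $\Sigma$. $P_n$ is the path on $n$ vertices and $\vee$ denotes the join of vertex-disjoint graphs. *)

theory Defs
  imports Main
begin

datatype 'a ugraph = UGraph (verts: "'a set") (edges: "'a set set")

definition simple_graph :: "'a ugraph \<Rightarrow> bool" where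
  "simple_graph G \<longleftrightarrow> finite (verts G) \<and> (\<forall>e\<in>edges G. e \<subseteq> verts G \<and> card e = 2)"

definition delete_edges :: "'a ugraph \<Rightarrow> 'a set set \<Rightarrow> 'a ugraph" where
  "delete_edges G F = UGraph (verts G) (edges G - F)"

(* The graphs are meant to be vertex-disjoint. *)
definition join :: "'a ugraph \<Rightarrow> 'a ugraph \<Rightarrow> 'a ugraph" where
  "join G H = UGraph (verts G \<union> verts H)
     (edges G \<union> edges H \<union> {{u, v} | u v. u \<in> verts G \<and> v \<in> verts H})"

definition complete_graph :: "'a set \<Rightarrow> 'a ugraph" where
  "complete_graph V = UGraph V {{u, v} | u v. u \<in> V \<and> v \<in> V \<and> u \<noteq> v}"

definition path_graph :: "nat \<Rightarrow> nat ugraph" where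
  "path_graph n = UGraph {1..n} {{i, i + 1} | i. 1 \<le> i \<and> i < n}"

(* Vertex 0 is the hub; it lies outside the vertex set {1..n} of the path. *)
definition fan_graph :: "nat \<Rightarrow> nat ugraph" where
  "fan_graph n = join (complete_graph {0}) (path_graph n)"

(* Only the values on the edges matter. *)
definition signature :: "'a ugraph \<Rightarrow> ('a set \<Rightarrow> int) \<Rightarrow> bool" where
  "signature G \<sigma> \<longleftrightarrow> (\<forall>e\<in>edges G. \<sigma> e \<in> {1, -1})"

(* The edge joining the last vertex to the first is included (i = length vs - 1). *)
definition cycle_edges :: "'a list \<Rightarrow> 'a set set" where
  "cycle_edges vs = {{vs ! i, vs ! (Suc i mod length vs)} | i. i < length vs}"

definition is_cycle :: "'a ugraph \<Rightarrow> 'a list \<Rightarrow> bool" where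
  "is_cycle G vs \<longleftrightarrow>
     3 \<le> length vs \<and> distinct vs \<and> set vs \<subseteq> verts G \<and> cycle_edges vs \<subseteq> edges G"

definition edges_sign :: "('a set \<Rightarrow> int) \<Rightarrow> 'a set set \<Rightarrow> int" where
  "edges_sign \<sigma> C = (\<Prod>e\<in>C. \<sigma> e)"

definition balanced :: "'a ugraph \<Rightarrow> ('a set \<Rightarrow> int) \<Rightarrow> bool" where
  "balanced G \<sigma> \<longleftrightarrow> (\<forall>vs. is_cycle G vs \<longrightarrow> edges_sign \<sigma> (cycle_edges vs) = 1)"

definition frustration_index :: "'a ugraph \<Rightarrow> ('a set \<Rightarrow> int) \<Rightarrow> nat" where
  "frustration_index G \<sigma> = Min {card F | F. F \<subseteq> edges G \<and> balanced (delete_edges G F) \<sigma>}"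

(* A triangle is identified with its edge set, so that the different vertex
   lists traversing it count once. *)
definition negative_triangles :: "'a ugraph \<Rightarrow> ('a set \<Rightarrow> int) \<Rightarrow> 'a set set set" where
  "negative_triangles G \<sigma> =
     {cycle_edges vs | vs. is_cycle G vs \<and> length vs = 3 \<and> edges_sign \<sigma> (cycle_edges vs) = -1}"

definition negative_triangle_packing :: "'a ugraph \<Rightarrow> ('a set \<Rightarrow> int) \<Rightarrow> nat" where
  "negative_triangle_packing G \<sigma> =
     Max {card T | T. T \<subseteq> negative_triangles G \<sigma> \<and> (\<forall>A\<in>T. \<forall>B\<in>T. A \<noteq> B \<longrightarrow> A \<inter> B = {})}"

lemma simple_graph_finite_edges:
  assumes "simple_graph G"
  shows "finite (edges G)"
proof (rule finite_subset)
  show "edges G \<subseteq> Pow (verts G)" using assms by (auto simp: simple_graph_def)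
  show "finite (Pow (verts G))" using assms by (simp add: simple_graph_def)
qed

lemma simple_graph_fan_graph: "simple_graph (fan_graph n)"
  by (auto simp: simple_graph_def fan_graph_def join_def complete_graph_def path_graph_def card_insert_if)

(* The minimum and the maximum above range over finite nonempty sets. *)

lemma frustration_index_attained:
  assumes "simple_graph G"
  shows "finite {card F | F. F \<subseteq> edges G \<and> balanced (delete_edges G F) \<sigma>}"
    and "{card F | F. F \<subseteq> edges G \<and> balanced (delete_edges G F) \<sigma>} \<noteq> {}"
proof -
  have fin: "finite (edges G)" using assms by (rule simple_graph_finite_edges)
  have "finite (card ` Pow (edges G))" using fin by simp
  then show "finite {card F | F. F \<subseteq> edges G \<and> balanced (delete_edges G F) \<sigma>}"
    by (rule rev_finite_subset) auto
  have "balanced (delete_edges G (edges G)) \<sigma>"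
    by (auto simp: balanced_def is_cycle_def delete_edges_def cycle_edges_def edges_sign_def)
  then show "{card F | F. F \<subseteq> edges G \<and> balanced (delete_edges G F) \<sigma>} \<noteq> {}"
    by blast
qed

lemma negative_triangle_packing_attained:
  assumes "simple_graph G"
  shows "finite {card T | T. T \<subseteq> negative_triangles G \<sigma> \<and> (\<forall>A\<in>T. \<forall>B\<in>T. A \<noteq> B \<longrightarrow> A \<inter> B = {})}"
    and "{card T | T. T \<subseteq> negative_triangles G \<sigma> \<and> (\<forall>A\<in>T. \<forall>B\<in>T. A \<noteq> B \<longrightarrow> A \<inter> B = {})} \<noteq> {}"
proof -
  have "negative_triangles G \<sigma> \<subseteq> Pow (edges G)"
    by (auto simp: negative_triangles_def is_cycle_def)
  then have "finite (negative_triangles G \<sigma>)"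
    using simple_graph_finite_edges[OF assms] by (meson finite_Pow_iff finite_subset)
  then have "finite (card ` Pow (negative_triangles G \<sigma>))" by simp
  then show "finite {card T | T. T \<subseteq> negative_triangles G \<sigma> \<and> (\<forall>A\<in>T. \<forall>B\<in>T. A \<noteq> B \<longrightarrow> A \<inter> B = {})}"
    by (rule rev_finite_subset) auto
  show "{card T | T. T \<subseteq> negative_triangles G \<sigma> \<and> (\<forall>A\<in>T. \<forall>B\<in>T. A \<noteq> B \<longrightarrow> A \<inter> B = {})} \<noteq> {}"
    by blast
qed

end

theory Submission
  imports Defs
begin

text \<open>
  Each triangle of a packing of negative triangles must lose an edge, so the packing number is a
  lower bound for the frustration index. Conversely, for every function \<open>s\<close> from the vertices to
  \<open>{1, -1}\<close>, deleting the edges \<open>uv\<close> with \<open>\<sigma>(uv) \<noteq> s(u) s(v)\<close> leaves a balanced graph. In the fan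
  choose triangles greedily from left to right, taking the negative triangle on \<open>0, i, i + 1\<close>
  unless the triangle before it was taken. One edge per chosen triangle repairs everything: the
  spoke shared with the next triangle if that one is negative too (which repairs both), and
  otherwise the path edge.
\<close>

lemma cycle_edges_image:
  "cycle_edges vs = (\<lambda>i. {vs ! i, vs ! (Suc i mod length vs)}) ` {..<length vs}"
  by (auto simp: cycle_edges_def)

text \<open>Two positions giving the same edge coincide or are cyclic successors of each other. The
  latter would force length 2.\<close>

lemma inj_on_cycle_edge:
  assumes "distinct vs" "3 \<le> length vs"
  shows "inj_on (\<lambda>i. {vs ! i, vs ! (Suc i mod length vs)}) {..<length vs}"
proof (rule inj_onI)
  fix i j
  assume ij: "i \<in> {..<length vs}" "j \<in> {..<length vs}"
    and eq: "{vs ! i, vs ! (Suc i mod length vs)} = {vs ! j, vs ! (Suc j mod length vs)}"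
  have lt: "Suc k mod length vs < length vs" for k
    using assms(2) by (intro mod_less_divisor) linarith
  have "i = j \<or> i = Suc j mod length vs \<and> Suc i mod length vs = j"
    using eq ij assms(1) lt by (auto simp: doubleton_eq_iff nth_eq_iff_index_eq)
  then show "i = j"
    using ij assms(2) by (auto simp: mod_Suc split: if_splits)
qed

lemma prod_cyclic_shift:
  fixes f :: "nat \<Rightarrow> 'a::comm_monoid_mult"
  shows "(\<Prod>i<n. f (Suc i mod n)) = (\<Prod>i<n. f i)"
proof (cases n)
  case (Suc m)
  have "(\<Prod>i<Suc m. f (Suc i mod Suc m)) = (\<Prod>i<m. f (Suc i)) * f 0"
    by simp
  also have "\<dots> = (\<Prod>i<Suc m. f i)"
    unfolding prod.lessThan_Suc_shift by (simp add: mult.commute)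
  finally show ?thesis using Suc by simp
qed simp

text \<open>Along a cycle every vertex is once the first and once the second end of an edge, so the
  sign of the cycle is a product of squares of values of \<open>s\<close>, hence 1.\<close>

lemma balanced_if_potential:
  assumes s: "\<And>v. v \<in> verts G \<Longrightarrow> s v \<in> {1, -1}"
    and \<sigma>: "\<And>e. e \<in> edges G \<Longrightarrow> \<sigma> e = prod s e"
  shows "balanced G \<sigma>"
  unfolding balanced_def
proof (intro allI impI)
  fix vs assume cyc: "is_cycle G vs"
  let ?e = "\<lambda>i. {vs ! i, vs ! (Suc i mod length vs)}"
  have len: "3 \<le> length vs" and dist: "distinct vs" and sub: "set vs \<subseteq> verts G"
    and E: "cycle_edges vs \<subseteq> edges G"
    using cyc by (auto simp: is_cycle_def)
  note im = cycle_edges_image[of vs]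
  have edge: "\<sigma> (?e i) = s (vs ! i) * s (vs ! (Suc i mod length vs))" if i: "i < length vs" for i
  proof -
    have "Suc i mod length vs < length vs"
      using i by (intro mod_less_divisor) linarith
    \<comment> \<open>The ends must differ, or \<open>prod s\<close> over the edge would have one
      factor instead of two.\<close>
    moreover have "i \<noteq> Suc i mod length vs"
      using i len by (simp add: mod_Suc)
    ultimately have "vs ! i \<noteq> vs ! (Suc i mod length vs)"
      using i dist by (simp add: nth_eq_iff_index_eq)
    moreover have "?e i \<in> edges G" using E im i by blast
    ultimately show ?thesis using \<sigma> by simp
  qed
  have sq: "s (vs ! i) * s (vs ! i) = 1" if "i < length vs" for i
    using s[of "vs ! i"] sub that nth_mem by fastforce
  have "edges_sign \<sigma> (cycle_edges vs) = (\<Prod>i<length vs. \<sigma> (?e i))"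
    unfolding edges_sign_def im by (simp add: prod.reindex[OF inj_on_cycle_edge[OF dist len]])
  also have "\<dots> = (\<Prod>i<length vs. s (vs ! i)) * (\<Prod>i<length vs. s (vs ! (Suc i mod length vs)))"
    by (simp add: edge prod.distrib)
  also have "\<dots> = (\<Prod>i<length vs. s (vs ! i) * s (vs ! i))"
    by (simp add: prod_cyclic_shift[where f = "\<lambda>i. s (vs ! i)"] prod.distrib)
  also have "\<dots> = 1"
    using sq by simp
  finally show "edges_sign \<sigma> (cycle_edges vs) = 1" .
qed

lemma frustration_index_le_potential:
  assumes "simple_graph G" and "\<And>v. v \<in> verts G \<Longrightarrow> s v \<in> {1, -1}"
  shows "frustration_index G \<sigma> \<le> card {e \<in> edges G. \<sigma> e \<noteq> prod s e}" (is "_ \<le> card ?F")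
proof -
  have "balanced (delete_edges G ?F) \<sigma>"
    by (rule balanced_if_potential[where s = s]) (use assms(2) in \<open>auto simp: delete_edges_def\<close>)
  then show ?thesis
    unfolding frustration_index_def
    by (intro Min_le frustration_index_attained(1)[OF assms(1)]) blast
qed

text \<open>A negative triangle avoiding \<open>F\<close> would survive the deletion as a negative
  cycle.\<close>

lemma negative_triangle_hits:
  assumes "balanced (delete_edges G F) \<sigma>" "A \<in> negative_triangles G \<sigma>"
  shows "A \<inter> F \<noteq> {}"
proof
  assume "A \<inter> F = {}"
  with assms(2) obtain vs where "is_cycle (delete_edges G F) vs" "edges_sign \<sigma> (cycle_edges vs) = -1"
    by (auto simp: negative_triangles_def is_cycle_def delete_edges_def)
  with assms(1) show False by (simp add: balanced_def)
qed

text \<open>Choosing a point of \<open>F\<close> in each member of \<open>T\<close> is injective by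
  disjointness.\<close>

lemma card_disjoint_family_le_hitting_set:
  assumes "finite F" "\<And>A. A \<in> T \<Longrightarrow> A \<inter> F \<noteq> {}"
    and "\<And>A B. A \<in> T \<Longrightarrow> B \<in> T \<Longrightarrow> A \<noteq> B \<Longrightarrow> A \<inter> B = {}"
  shows "card T \<le> card F"
proof -
  define f where "f A = (SOME x. x \<in> A \<inter> F)" for A
  have f: "f A \<in> A \<inter> F" if "A \<in> T" for A
    unfolding f_def by (rule someI_ex) (use assms(2)[OF that] in blast)
  have "inj_on f T"
  proof (rule inj_onI, rule ccontr)
    fix A B assume "A \<in> T" "B \<in> T" "f A = f B" "A \<noteq> B"
    then show False using assms(3)[of A B] f[of A] f[of B] by auto
  qed
  then show ?thesis
    using f assms(1) by (intro card_inj_on_le[where f = f]) auto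
qed

lemma negative_triangle_packing_le_frustration_index:
  assumes "simple_graph G"
  shows "negative_triangle_packing G \<sigma> \<le> frustration_index G \<sigma>"
proof -
  have "frustration_index G \<sigma> \<in> {card F | F. F \<subseteq> edges G \<and> balanced (delete_edges G F) \<sigma>}"
    unfolding frustration_index_def by (rule Min_in[OF frustration_index_attained[OF assms]])
  then obtain F where F: "F \<subseteq> edges G" "balanced (delete_edges G F) \<sigma>"
    "frustration_index G \<sigma> = card F"
    by auto
  have "negative_triangle_packing G \<sigma> \<in> {card T | T. T \<subseteq> negative_triangles G \<sigma> \<and>
      (\<forall>A\<in>T. \<forall>B\<in>T. A \<noteq> B \<longrightarrow> A \<inter> B = {})}"
    unfolding negative_triangle_packing_def
    by (rule Max_in[OF negative_triangle_packing_attained[OF assms]])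
  then obtain T where T: "T \<subseteq> negative_triangles G \<sigma>"
    "\<forall>A\<in>T. \<forall>B\<in>T. A \<noteq> B \<longrightarrow> A \<inter> B = {}" "negative_triangle_packing G \<sigma> = card T"
    by auto
  have "finite F"
    using F(1) simple_graph_finite_edges[OF assms] finite_subset by blast
  then have "card T \<le> card F"
    using T negative_triangle_hits[OF F(2)]
    by (intro card_disjoint_family_le_hitting_set) auto
  then show ?thesis using F T by simp
qed

lemma card_le_negative_triangle_packing:
  assumes "simple_graph G" "T \<subseteq> negative_triangles G \<sigma>"
    and "\<And>A B. A \<in> T \<Longrightarrow> B \<in> T \<Longrightarrow> A \<noteq> B \<Longrightarrow> A \<inter> B = {}"
  shows "card T \<le> negative_triangle_packing G \<sigma>"
  unfolding negative_triangle_packing_def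
  by (intro Max_ge negative_triangle_packing_attained(1)[OF assms(1)]) (use assms in blast)

lemma verts_fan_graph: "verts (fan_graph n) = {0..n}"
  by (auto simp: fan_graph_def join_def complete_graph_def path_graph_def)

lemma edges_fan_graph:
  "edges (fan_graph n) = {{0, i} | i. 1 \<le> i \<and> i \<le> n} \<union> {{i, Suc i} | i. 1 \<le> i \<and> i < n}"
  by (auto simp: fan_graph_def join_def complete_graph_def path_graph_def)

definition fan_triangle :: "nat \<Rightarrow> nat set set" where
  "fan_triangle i = {{0, i}, {i, Suc i}, {0, Suc i}}"

lemma cycle_edges_triangle: "cycle_edges [a, b, c] = {{a, b}, {b, c}, {a, c}}"
proof -
  have "{..<length [a, b, c]} = {0, 1, 2}" by auto
  then show ?thesis
    unfolding cycle_edges_image by (simp add: insert_commute)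
qed

lemma edges_sign_fan_triangle:
  "1 \<le> i \<Longrightarrow> edges_sign \<sigma> (fan_triangle i) = \<sigma> {0, i} * \<sigma> {i, Suc i} * \<sigma> {0, Suc i}"
  by (simp add: edges_sign_def fan_triangle_def doubleton_eq_iff)

lemma fan_triangle_negative:
  assumes "1 \<le> i" "i < n" "edges_sign \<sigma> (fan_triangle i) = -1"
  shows "fan_triangle i \<in> negative_triangles (fan_graph n) \<sigma>"
proof -
  have eq: "cycle_edges [0, i, Suc i] = fan_triangle i"
    by (simp add: cycle_edges_triangle fan_triangle_def)
  have "is_cycle (fan_graph n) [0, i, Suc i]"
    unfolding is_cycle_def eq
    using assms by (auto simp: verts_fan_graph edges_fan_graph fan_triangle_def)
  then show ?thesis
    unfolding negative_triangles_def using assms(3) eq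
    by (intro CollectI exI[of _ "[0, i, Suc i]"]) simp
qed

lemma fan_triangle_disjoint:
  assumes "1 \<le> i" "1 \<le> j" "i \<noteq> j" "j \<noteq> Suc i" "i \<noteq> Suc j"
  shows "fan_triangle i \<inter> fan_triangle j = {}"
  using assms by (auto simp: fan_triangle_def doubleton_eq_iff)

text \<open>
  If \<open>P i\<close> says that the triangle on \<open>0, i, i + 1\<close> is negative, then \<open>shared_spoke P i\<close> says that the
  greedy procedure deletes the spoke \<open>0 i\<close>. It takes triangle \<open>i\<close> iff \<open>P i\<close> holds and this spoke
  is not deleted.
\<close>

primrec shared_spoke :: "(nat \<Rightarrow> bool) \<Rightarrow> nat \<Rightarrow> bool" where
  "shared_spoke P 0 = False"
| "shared_spoke P (Suc i) = (P i \<and> \<not> shared_spoke P i \<and> P (Suc i))"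

lemma frustration_index_fan_le_packing:
  assumes sig: "signature (fan_graph n) \<sigma>"
  shows "frustration_index (fan_graph n) \<sigma> \<le> negative_triangle_packing (fan_graph n) \<sigma>"
proof -
  define P where "P i \<longleftrightarrow> 1 \<le> i \<and> i < n \<and> edges_sign \<sigma> (fan_triangle i) = -1" for i
  define d where "d = shared_spoke P"
  define S where "S = {i. P i \<and> \<not> d i}"
  define s where "s i = (if i = 0 then 1 else if d i then - \<sigma> {0, i} else \<sigma> {0, i})" for i
  let ?del = "\<lambda>i. if d (Suc i) then {0, Suc i} else {i, Suc i}"
  have d_0: "\<not> d 0" and d_Suc: "d (Suc i) \<longleftrightarrow> P i \<and> \<not> d i \<and> P (Suc i)" for i
    by (simp_all add: d_def)
  have d_P: "P i" if "d i" for i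
    using that d_0 d_Suc by (cases i) auto
  have spoke_sign: "\<sigma> {0, i} \<in> {1, -1}" if "1 \<le> i" "i \<le> n" for i
    using sig that unfolding signature_def edges_fan_graph by blast
  have path_sign: "\<sigma> {i, Suc i} \<in> {1, -1}" if "1 \<le> i" "i < n" for i
    using sig that unfolding signature_def edges_fan_graph by blast
  have fin: "finite S"
    by (rule finite_subset[of _ "{..<n}"]) (auto simp: S_def P_def)
  have disj: "fan_triangle i \<inter> fan_triangle j = {}" if "i \<in> S" "j \<in> S" "i \<noteq> j" for i j
    using that by (intro fan_triangle_disjoint) (auto simp: S_def P_def d_Suc)
  have "inj_on fan_triangle S"
  proof (rule inj_onI, rule ccontr)
    fix i j assume "i \<in> S" "j \<in> S" "fan_triangle i = fan_triangle j" "i \<noteq> j"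
    then show False using disj[of i j] by (simp add: fan_triangle_def)
  qed
  then have "card S = card (fan_triangle ` S)" by (simp add: card_image)
  also have "\<dots> \<le> negative_triangle_packing (fan_graph n) \<sigma>"
    using disj
    by (intro card_le_negative_triangle_packing simple_graph_fan_graph)
      (auto simp: S_def P_def intro!: fan_triangle_negative)
  finally have packing: "card S \<le> negative_triangle_packing (fan_graph n) \<sigma>" .
  have s: "s v \<in> {1, -1}" if "v \<in> verts (fan_graph n)" for v
    using that spoke_sign[of v] by (cases "v = 0") (auto simp: verts_fan_graph s_def)
  have frustration:
    "frustration_index (fan_graph n) \<sigma> \<le> card {e \<in> edges (fan_graph n). \<sigma> e \<noteq> prod s e}"
    using s by (intro frustration_index_le_potential simple_graph_fan_graph)
  have "{e \<in> edges (fan_graph n). \<sigma> e \<noteq> prod s e} \<subseteq> ?del ` S"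
  proof
    fix e assume e: "e \<in> {e \<in> edges (fan_graph n). \<sigma> e \<noteq> prod s e}"
    then consider (spoke) i where "e = {0, i}" "1 \<le> i" "i \<le> n"
      | (path) i where "e = {i, Suc i}" "1 \<le> i" "i < n"
      by (auto simp: edges_fan_graph)
    then show "e \<in> ?del ` S"
    proof cases
      case spoke
      then obtain j where j: "i = Suc j" by (cases i) auto
      have "d i" using e spoke by (auto simp: s_def split: if_splits)
      then have "j \<in> S" "d (Suc j)" using j d_Suc by (auto simp: S_def)
      then show ?thesis using spoke j by (auto intro!: rev_image_eqI[of j])
    next
      case path
      have viol: "\<sigma> {i, Suc i} \<noteq> s i * s (Suc i)" using e path by simp
      have neg: "P i \<longleftrightarrow> \<sigma> {0, i} * \<sigma> {i, Suc i} * \<sigma> {0, Suc i} = -1"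
        using path edges_sign_fan_triangle by (simp add: P_def)
      have signs: "\<sigma> {0, i} \<in> {1, -1}" "\<sigma> {0, Suc i} \<in> {1, -1}" "\<sigma> {i, Suc i} \<in> {1, -1}"
        using path(2,3) spoke_sign[of i] spoke_sign[of "Suc i"] path_sign[of i] by simp_all
      have val: "s i = (if d i then - \<sigma> {0, i} else \<sigma> {0, i})"
        "s (Suc i) = (if d (Suc i) then - \<sigma> {0, Suc i} else \<sigma> {0, Suc i})"
        using path(2) by (simp_all add: s_def)
      have "\<sigma> {i, Suc i} = (if P i then - 1 else 1) * (\<sigma> {0, i} * \<sigma> {0, Suc i})"
        using signs unfolding neg by (elim insertE emptyE) simp_all
      then have "P i \<and> \<not> d i \<and> \<not> d (Suc i)"
        using viol d_P[of i] d_Suc[of i] unfolding val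
        by (cases "P i"; cases "d i"; cases "P (Suc i)") simp_all
      then show ?thesis using path by (auto simp: S_def intro!: rev_image_eqI[of i])
    qed
  qed
  then have "card {e \<in> edges (fan_graph n). \<sigma> e \<noteq> prod s e} \<le> card S"
    by (rule surj_card_le[OF fin])
  then show ?thesis using frustration packing by simp
qed

theorem theorem18:
  fixes n :: nat and \<sigma> :: "nat set \<Rightarrow> int"
  assumes "n \<ge> 1"
    and "signature (fan_graph n) \<sigma>"
  shows "frustration_index (fan_graph n) \<sigma> = negative_triangle_packing (fan_graph n) \<sigma>"
  using frustration_index_fan_le_packing[OF assms(2)]
    negative_triangle_packing_le_frustration_index[OF simple_graph_fan_graph]
  by (rule antisym)

end
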